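(* Let $n$ be even, let $S$ be a constant skew-symmetric real $n\times n$ matrix, let $H:\mathbb{R}^n\to\mathbb{R}$ be a $C^\infty$ function, and consider the Hamiltonian system $\dot z=f(z)=S\nabla H(z)$ on $\mathbb{R}^n$. Let $h\neq0$ be a time step, and let $z_0\in\mathbb{R}^n$ and $z_1=\Phi_h(z_0)\in\mathbb{R}^n$ be related by the sixth order AVF method $$z_1=z_0+\Big\{hI-\frac{h^3}{12}A_0+\frac{h^5}{720}\Big[6A_1-A_2+A_3-A_4-\frac32A_5-\frac32A_6+3A_7+3A_8\Big]\Big\}\int_0^1 f(\xi z_1+(1-\xi)z_0)\,d\xi ,$$ where $I$ is the $n\times n$ identity matrix and $A_0,\ldots,A_8$ are the $n\times n$ matrices defined by their action on $w\in\mathbb{R}^n$, with $f$ and all its derivatives $f',f'',f'''$ evaluated at the midpoint $\hat z=\frac{z_0+z_1}{2}$: $$A_0w=f'f'w,\quad A_1w=f'f'f'f'w,\quad A_2w=f''(f''(w,f),f),$$ $$A_3w=f'f'f''(w,f),\quad A_4w=f''(f'f'w,f),\quad A_5w=f'f'''(w,f,f),$$ $$A_6w=f'''(f'w,f,f),\quad A_7w=f''(f'w,f'f),\quad A_8w=f'f''(w,f'f).$$ Then the method preserves the discrete energy, i.e. $$\frac1h\big(H(z_1)-H(z_0)\big)=0 .$$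
   Context: $f^{(m)}(\hat z)$ denotes the $m$-th derivative of $f$ at $\hat z$, regarded as a symmetric $m$-linear map $(\mathbb{R}^n)^m\to\mathbb{R}^n$. The method is implicit: $z_1=\Phi_h(z_0)$ denotes a solution of the displayed equation. *)

theory Defs
  imports "HOL-Analysis.Analysis"
begin

(* iter_deriv f [v1, ..., vm] x is the m-th derivative of f at x, viewed as an m-linear map,
   applied to (v1, ..., vm): the directions are constants, and v1 is the outermost one. *)
primrec iter_deriv ::
  "('a::real_normed_vector \<Rightarrow> 'b::real_normed_vector) \<Rightarrow> 'a list \<Rightarrow> 'a \<Rightarrow> 'b" where
  "iter_deriv f [] = f"
| "iter_deriv f (v # vs) = (\<lambda>x. frechet_derivative (iter_deriv f vs) (at x) v)"

(* Derivatives of all orders exist everywhere. In finite dimension the m-th derivative, as a map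
   into the multilinear maps, is differentiable iff its evaluation at every (v1, ..., vm) is;
   continuity of each derivative follows from differentiability. *)
definition C_infinity :: "('a::euclidean_space \<Rightarrow> 'b::real_normed_vector) \<Rightarrow> bool" where
  "C_infinity f \<longleftrightarrow> (\<forall>vs x. iter_deriv f vs differentiable (at x))"

definition gradient :: "('a::real_inner \<Rightarrow> real) \<Rightarrow> 'a \<Rightarrow> 'a" where
  "gradient H z = (THE D. GDERIV H z :> D)"

lemma GDERIV_gradient:
  fixes H :: "'a::euclidean_space \<Rightarrow> real"
  assumes "H differentiable (at z)"
  shows "GDERIV H z :> gradient H z"
proof -
  obtain L where L: "(H has_derivative L) (at z)"
    using assms by (auto simp: differentiable_def)
  then interpret L: linear L
    by (rule has_derivative_linear)
  define D where "D = adjoint L 1"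
  have "L = (\<lambda>v. v \<bullet> D)"
    using adjoint_works[OF L.linear_axioms, of _ 1] by (auto simp: D_def)
  with L have D: "GDERIV H z :> D"
    by (simp add: gderiv_def)
  have "E = D" if "GDERIV H z :> E" for E
  proof -
    have "(\<lambda>v. v \<bullet> E) = (\<lambda>v. v \<bullet> D)"
      using that D unfolding gderiv_def by (rule has_derivative_unique)
    then show ?thesis
      by (metis vector_eq_ldot)
  qed
  with D show ?thesis
    unfolding gradient_def by (rule theI)
qed

definition hamiltonian_field :: "real^'n^'n \<Rightarrow> (real^'n \<Rightarrow> real) \<Rightarrow> real^'n \<Rightarrow> real^'n" where
  "hamiltonian_field S H z = S *v gradient H z"

(* The elementary-differential matrices; f and its derivatives are evaluated at z. *)
definition A0 :: "(real^'n \<Rightarrow> real^'n) \<Rightarrow> real^'n \<Rightarrow> real^'n^'n" where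
  "A0 f z = matrix (\<lambda>w. let D = (\<lambda>vs. iter_deriv f vs z) in
     D [D [w]])"

definition A1 :: "(real^'n \<Rightarrow> real^'n) \<Rightarrow> real^'n \<Rightarrow> real^'n^'n" where
  "A1 f z = matrix (\<lambda>w. let D = (\<lambda>vs. iter_deriv f vs z) in
     D [D [D [D [w]]]])"

definition A2 :: "(real^'n \<Rightarrow> real^'n) \<Rightarrow> real^'n \<Rightarrow> real^'n^'n" where
  "A2 f z = matrix (\<lambda>w. let D = (\<lambda>vs. iter_deriv f vs z) in
     D [D [w, f z], f z])"

definition A3 :: "(real^'n \<Rightarrow> real^'n) \<Rightarrow> real^'n \<Rightarrow> real^'n^'n" where
  "A3 f z = matrix (\<lambda>w. let D = (\<lambda>vs. iter_deriv f vs z) in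
     D [D [D [w, f z]]])"

definition A4 :: "(real^'n \<Rightarrow> real^'n) \<Rightarrow> real^'n \<Rightarrow> real^'n^'n" where
  "A4 f z = matrix (\<lambda>w. let D = (\<lambda>vs. iter_deriv f vs z) in
     D [D [D [w]], f z])"

definition A5 :: "(real^'n \<Rightarrow> real^'n) \<Rightarrow> real^'n \<Rightarrow> real^'n^'n" where
  "A5 f z = matrix (\<lambda>w. let D = (\<lambda>vs. iter_deriv f vs z) in
     D [D [w, f z, f z]])"

definition A6 :: "(real^'n \<Rightarrow> real^'n) \<Rightarrow> real^'n \<Rightarrow> real^'n^'n" where
  "A6 f z = matrix (\<lambda>w. let D = (\<lambda>vs. iter_deriv f vs z) in
     D [D [w], f z, f z])"

definition A7 :: "(real^'n \<Rightarrow> real^'n) \<Rightarrow> real^'n \<Rightarrow> real^'n^'n" where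
  "A7 f z = matrix (\<lambda>w. let D = (\<lambda>vs. iter_deriv f vs z) in
     D [D [w], D [f z]])"

definition A8 :: "(real^'n \<Rightarrow> real^'n) \<Rightarrow> real^'n \<Rightarrow> real^'n^'n" where
  "A8 f z = matrix (\<lambda>w. let D = (\<lambda>vs. iter_deriv f vs z) in
     D [D [w, D [f z]]])"

(* The method is implicit in z1, so a step is a relation between z0 and z1. *)
definition avf6_step :: "(real^'n \<Rightarrow> real^'n) \<Rightarrow> real \<Rightarrow> real^'n \<Rightarrow> real^'n \<Rightarrow> bool" where
  "avf6_step f h z0 z1 \<longleftrightarrow>
     (let z = (1 / 2) *\<^sub>R (z0 + z1) in
      z1 = z0 +
        (h *\<^sub>R mat 1 - (h ^ 3 / 12) *\<^sub>R A0 f z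
         + (h ^ 5 / 720) *\<^sub>R
             (6 *\<^sub>R A1 f z - A2 f z + A3 f z - A4 f z
              - (3 / 2) *\<^sub>R A5 f z - (3 / 2) *\<^sub>R A6 f z
              + 3 *\<^sub>R A7 f z + 3 *\<^sub>R A8 f z))
        *v integral {0..1} (\<lambda>\<xi>. f (\<xi> *\<^sub>R z1 + (1 - \<xi>) *\<^sub>R z0)))"

end

theory Submission
  imports Defs
begin

text \<open>Let \<open>g\<close> be the average of \<open>\<nabla>H\<close> over the segment from \<open>z0\<close> to \<open>z1\<close>. Then
  \<open>H z1 - H z0 = (z1 - z0) \<bullet> g\<close>, while the method says \<open>z1 - z0 = M S g\<close> for the bracketed matrix
  \<open>M\<close>. Every derivative of \<open>f = S \<nabla>H\<close> is \<open>S\<close> applied to a derivative of \<open>\<nabla>H\<close>, which is self-adjoint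
  in its first argument by the symmetry of the derivatives of \<open>H\<close>. Hence \<open>A\<^sub>i S\<close> is an alternating
  product of \<open>S\<close> and self-adjoint maps; it is skew for \<open>i = 0, 1, 2\<close>, and the remaining terms cancel
  in the pairs \<open>(A\<^sub>3, A\<^sub>4)\<close>, \<open>(A\<^sub>5, A\<^sub>6)\<close>, \<open>(A\<^sub>7, A\<^sub>8)\<close> under transposition. So \<open>M S\<close> is skew and
  \<open>M S g \<bullet> g = 0\<close>.\<close>

section \<open>Symmetry of mixed second derivatives\<close>

lemma has_real_derivative_along_line:
  fixes f :: "'a::real_normed_vector \<Rightarrow> real"
  assumes "f differentiable (at (p + t *\<^sub>R v))"
  shows "((\<lambda>t. f (p + t *\<^sub>R v)) has_real_derivative
    frechet_derivative f (at (p + t *\<^sub>R v)) v) (at t)"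
proof -
  have f: "(f has_derivative frechet_derivative f (at (p + t *\<^sub>R v))) (at (p + t *\<^sub>R v))"
    using assms by (simp add: frechet_derivative_works)
  have "((\<lambda>t. f (p + t *\<^sub>R v)) has_derivative
      (\<lambda>s. frechet_derivative f (at (p + t *\<^sub>R v)) (s *\<^sub>R v))) (at t)"
    by (rule has_derivative_compose[where f = "\<lambda>t. p + t *\<^sub>R v" and g = f, OF _ f]) (auto intro!: derivative_eq_intros)
  then show ?thesis
    by (simp add: has_field_derivative_def linear_cmul[OF has_derivative_linear[OF f]] mult_commute_abs)
qed

text \<open>Two applications of the mean value theorem: first along \<open>v\<close>, to the
  difference of \<open>f\<close> on two parallel segments that are \<open>s *\<^sub>R w\<close>
  apart, then along \<open>w\<close>, to the \<open>v\<close>-derivative. The left-hand side is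
  symmetric in \<open>v\<close> and \<open>w\<close>, which lets the two orders of differentiation
  be compared.\<close>

lemma second_difference_mvt:
  fixes f :: "'a::real_normed_vector \<Rightarrow> real"
  assumes f: "\<And>x. f differentiable (at x)"
    and fv: "\<And>x. (\<lambda>y. frechet_derivative f (at y) v) differentiable (at x)"
    and s: "s > 0"
  obtains a b where "0 < a" "a < s" "0 < b" "b < s"
    "f (x + s *\<^sub>R v + s *\<^sub>R w) - f (x + s *\<^sub>R v) - f (x + s *\<^sub>R w) + f x =
      s * (s * frechet_derivative (\<lambda>y. frechet_derivative f (at y) v) (at (x + a *\<^sub>R v + b *\<^sub>R w)) w)"
proof -
  let ?D = "\<lambda>y. frechet_derivative f (at y) v"
  let ?\<phi> = "\<lambda>t. f ((x + s *\<^sub>R w) + t *\<^sub>R v) - f (x + t *\<^sub>R v)"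
  have "(?\<phi> has_real_derivative ?D ((x + s *\<^sub>R w) + t *\<^sub>R v) - ?D (x + t *\<^sub>R v)) (at t)" for t
    by (intro DERIV_diff has_real_derivative_along_line f)
  from MVT2[OF s this] obtain a where a: "0 < a" "a < s"
    "?\<phi> s - ?\<phi> 0 = s * (?D ((x + s *\<^sub>R w) + a *\<^sub>R v) - ?D (x + a *\<^sub>R v))"
    by auto
  have "((\<lambda>t. ?D ((x + a *\<^sub>R v) + t *\<^sub>R w)) has_real_derivative
    frechet_derivative ?D (at ((x + a *\<^sub>R v) + t *\<^sub>R w)) w) (at t)" for t
    by (intro has_real_derivative_along_line fv)
  from MVT2[OF s this] obtain b where b: "0 < b" "b < s"
    "?D ((x + a *\<^sub>R v) + s *\<^sub>R w) - ?D (x + a *\<^sub>R v) =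
      s * frechet_derivative ?D (at ((x + a *\<^sub>R v) + b *\<^sub>R w)) w"
    by auto
  show thesis
    using a b by (intro that[of a b]) (auto simp: algebra_simps)
qed

text \<open>Schwarz's theorem. Both mixed derivatives, taken at suitable points near
  \<open>x\<close>, equal the same second difference divided by \<open>s\<close> squared, so
  continuity forbids a gap between them at \<open>x\<close>.\<close>

lemma mixed_derivative_commute:
  fixes f :: "'a::real_normed_vector \<Rightarrow> real"
  assumes f: "\<And>x. f differentiable (at x)"
    and fv: "\<And>v x. (\<lambda>y. frechet_derivative f (at y) v) differentiable (at x)"
    and cont: "\<And>v w. isCont (\<lambda>y. frechet_derivative (\<lambda>y. frechet_derivative f (at y) v) (at y) w) x"
  shows "frechet_derivative (\<lambda>y. frechet_derivative f (at y) v) (at x) w =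
    frechet_derivative (\<lambda>y. frechet_derivative f (at y) w) (at x) v"
proof (rule ccontr)
  let ?D = "\<lambda>v w y. frechet_derivative (\<lambda>y. frechet_derivative f (at y) v) (at y) w"
  assume ne: "?D v w x \<noteq> ?D w v x"
  define e where "e = dist (?D v w x) (?D w v x)"
  have e: "e / 2 > 0" using ne by (simp add: e_def)
  obtain d1 where d1: "d1 > 0" "\<And>y. dist y x < d1 \<Longrightarrow> dist (?D v w y) (?D v w x) < e / 2"
    using cont[of v w] e unfolding continuous_at_eps_delta by blast
  obtain d2 where d2: "d2 > 0" "\<And>y. dist y x < d2 \<Longrightarrow> dist (?D w v y) (?D w v x) < e / 2"
    using cont[of w v] e unfolding continuous_at_eps_delta by blast
  \<comment> \<open>This scale keeps the parallelogram spanned at \<open>x\<close> by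
    \<open>s *\<^sub>R v\<close> and \<open>s *\<^sub>R w\<close> inside both balls. The summand 1
    covers \<open>v = w = 0\<close> and makes the bound strict.\<close>
  define s where "s = min d1 d2 / (1 + norm v + norm w)"
  have n: "1 + norm v + norm w > 0"
    by (simp add: add_pos_nonneg)
  have s: "s > 0"
    using d1 d2 n by (simp add: s_def)
  have near: "dist (x + a *\<^sub>R v + b *\<^sub>R w) x < min d1 d2"
    if "0 < a" "a < s" "0 < b" "b < s" for a b
  proof -
    have "dist (x + a *\<^sub>R v + b *\<^sub>R w) x \<le> norm (a *\<^sub>R v) + norm (b *\<^sub>R w)"
      by (metis add.assoc add_diff_cancel_left' dist_norm norm_triangle_ineq)
    also have "\<dots> \<le> s * norm v + s * norm w"
      using that by (intro add_mono) (auto intro: mult_right_mono)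
    also have "\<dots> < s * (1 + norm v + norm w)"
      using s by (simp add: algebra_simps)
    also have "\<dots> = min d1 d2"
      using n by (simp add: s_def)
    finally show ?thesis .
  qed
  obtain a b where ab: "0 < a" "a < s" "0 < b" "b < s"
    "f (x + s *\<^sub>R v + s *\<^sub>R w) - f (x + s *\<^sub>R v) - f (x + s *\<^sub>R w) + f x =
      s * (s * ?D v w (x + a *\<^sub>R v + b *\<^sub>R w))"
    using second_difference_mvt[OF f fv s] by metis
  obtain a' b' where ab': "0 < a'" "a' < s" "0 < b'" "b' < s"
    "f (x + s *\<^sub>R w + s *\<^sub>R v) - f (x + s *\<^sub>R w) - f (x + s *\<^sub>R v) + f x =
      s * (s * ?D w v (x + a' *\<^sub>R w + b' *\<^sub>R v))"
    using second_difference_mvt[OF f fv s] by metis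
  \<comment> \<open>Reordering the sums identifies the two second differences and brings the second
    intermediate point into the form treated by \<open>near\<close>.\<close>
  have swap: "x + a' *\<^sub>R w + b' *\<^sub>R v = x + b' *\<^sub>R v + a' *\<^sub>R w"
    "x + s *\<^sub>R w + s *\<^sub>R v = x + s *\<^sub>R v + s *\<^sub>R w"
    by (simp_all add: algebra_simps)
  have "s * (s * ?D v w (x + a *\<^sub>R v + b *\<^sub>R w)) = s * (s * ?D w v (x + b' *\<^sub>R v + a' *\<^sub>R w))"
    using ab(5) ab'(5) unfolding swap by linarith
  then have "?D v w (x + a *\<^sub>R v + b *\<^sub>R w) = ?D w v (x + b' *\<^sub>R v + a' *\<^sub>R w)"
    using s by simp
  moreover have "dist (?D v w (x + a *\<^sub>R v + b *\<^sub>R w)) (?D v w x) < e / 2"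
    using near[of a b] ab by (intro d1) auto
  moreover have "dist (?D w v (x + b' *\<^sub>R v + a' *\<^sub>R w)) (?D w v x) < e / 2"
    using near[of b' a'] ab' by (intro d2) auto
  ultimately show False
    using dist_triangle_half_r unfolding e_def by (metis order_less_irrefl)
qed

section \<open>Iterated derivatives of smooth functions\<close>

lemma iter_deriv_differentiable:
  "C_infinity f \<Longrightarrow> iter_deriv f vs differentiable (at x)"
  by (simp add: C_infinity_def)

text \<open>Schwarz's theorem for \<open>iter_deriv f vs\<close>; the second derivatives are
  continuous because they are differentiable. The directions in \<open>us\<close> only differentiate
  both sides further.\<close>

lemma iter_deriv_swap:
  fixes f :: "'a::euclidean_space \<Rightarrow> real"
  assumes "C_infinity f"
  shows "iter_deriv f (us @ v # w # vs) = iter_deriv f (us @ w # v # vs)"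
proof -
  have D: "iter_deriv f xs differentiable (at x)" for xs x
    using assms by (rule iter_deriv_differentiable)
  have "iter_deriv f (v # w # vs) x = iter_deriv f (w # v # vs) x" for x
    unfolding iter_deriv.simps
  proof (rule mixed_derivative_commute)
    show "iter_deriv f vs differentiable (at y)" for y
      by (rule D)
    show "(\<lambda>y. frechet_derivative (iter_deriv f vs) (at y) u) differentiable (at y)" for u y
      using D[of "u # vs" y] by simp
    show "isCont (\<lambda>y. frechet_derivative
        (\<lambda>y. frechet_derivative (iter_deriv f vs) (at y) u) (at y) u') x" for u u'
      using differentiable_imp_continuous_within[OF D[of "u' # u # vs" x]] by simp
  qed
  then have "iter_deriv f (v # w # vs) = iter_deriv f (w # v # vs)"
    by (rule ext)
  then show ?thesis
    by (induction us) simp_all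
qed

lemma iter_deriv_move:
  fixes f :: "'a::euclidean_space \<Rightarrow> real"
  assumes "C_infinity f"
  shows "iter_deriv f (us @ w # vs) = iter_deriv f (w # us @ vs)"
proof (induction us)
  case (Cons u us)
  have "iter_deriv f ((u # us) @ w # vs) = iter_deriv f (u # w # us @ vs)"
    using Cons by simp
  also have "\<dots> = iter_deriv f (w # u # us @ vs)"
    using iter_deriv_swap[OF assms, of "[]"] by simp
  finally show ?case by simp
qed simp

text \<open>Moving \<open>u\<close> to the front and \<open>w\<close> to the end swaps the outermost
  and innermost directions. This form is the source of self-adjointness, since pairing the gradient
  with a vector fills the innermost slot.\<close>

lemma iter_deriv_exchange:
  fixes f :: "'a::euclidean_space \<Rightarrow> real"
  assumes "C_infinity f"
  shows "iter_deriv f (w # vs @ [u]) = iter_deriv f (u # vs @ [w])"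
  using iter_deriv_move[OF assms, of "w # vs" u "[]"] iter_deriv_move[OF assms, of vs w "[]"]
  by simp

lemma linear_iter_deriv:
  assumes "iter_deriv f vs differentiable (at x)"
  shows "linear (\<lambda>w. iter_deriv f (w # vs) x)"
  using linear_frechet_derivative[OF assms] by simp

text \<open>The chain rule at each order; with multiplication by \<open>S\<close> as
  \<open>L\<close> it reduces derivatives of the field to derivatives of the gradient.\<close>

lemma iter_deriv_compose_bounded_linear:
  assumes L: "bounded_linear L" and D: "\<And>vs x. iter_deriv f vs differentiable (at x)"
  shows "iter_deriv (\<lambda>x. L (f x)) vs = (\<lambda>x. L (iter_deriv f vs x))"
proof (induction vs)
  case (Cons v vs)
  have d: "((\<lambda>x. L (iter_deriv f vs x)) has_derivative
      (\<lambda>v. L (frechet_derivative (iter_deriv f vs) (at x) v))) (at x)" for x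
    using D by (intro bounded_linear.has_derivative[OF L]) (simp add: frechet_derivative_works)
  then show ?case
    by (simp add: Cons frechet_derivative_at[OF d, symmetric])
qed simp

section \<open>Derivatives of the gradient\<close>

lemma gradient_inner:
  fixes H :: "'a::euclidean_space \<Rightarrow> real"
  assumes "H differentiable (at x)"
  shows "gradient H x \<bullet> u = frechet_derivative H (at x) u"
proof -
  have "(H has_derivative (\<lambda>u. u \<bullet> gradient H x)) (at x)"
    using GDERIV_gradient[OF assms] by (simp add: gderiv_def)
  then show ?thesis
    by (simp add: frechet_derivative_at[symmetric] inner_commute)
qed

text \<open>The coordinate expansion transfers smoothness from \<open>H\<close> to its gradient:
  differentiability at every order is read off from the finite sum.\<close>

lemma iter_deriv_gradient_sum:
  fixes H :: "'a::euclidean_space \<Rightarrow> real"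
  assumes "C_infinity H"
  shows "iter_deriv (gradient H) vs = (\<lambda>x. \<Sum>b\<in>Basis. iter_deriv H (vs @ [b]) x *\<^sub>R b)"
proof (induction vs)
  case Nil
  show ?case
    using iter_deriv_differentiable[OF assms, of "[]"]
    by (auto simp: gradient_inner[symmetric] euclidean_representation)
next
  case (Cons v vs)
  have d: "((\<lambda>x. \<Sum>b\<in>Basis. iter_deriv H (vs @ [b]) x *\<^sub>R b) has_derivative
      (\<lambda>v. \<Sum>b\<in>Basis. frechet_derivative (iter_deriv H (vs @ [b])) (at x) v *\<^sub>R b)) (at x)" for x
    using iter_deriv_differentiable[OF assms]
    by (intro has_derivative_sum has_derivative_scaleR_left) (simp add: frechet_derivative_works)
  then show ?case
    by (simp add: Cons frechet_derivative_at[OF d, symmetric])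
qed

lemma iter_deriv_gradient_differentiable:
  fixes H :: "'a::euclidean_space \<Rightarrow> real"
  assumes "C_infinity H"
  shows "iter_deriv (gradient H) vs differentiable (at x)"
  unfolding iter_deriv_gradient_sum[OF assms]
  using iter_deriv_differentiable[OF assms]
  by (intro differentiable_sum ballI differentiable_scaleR differentiable_const) auto

lemma iter_deriv_gradient_inner:
  fixes H :: "'a::euclidean_space \<Rightarrow> real"
  assumes "C_infinity H"
  shows "iter_deriv (gradient H) vs x \<bullet> u = iter_deriv H (vs @ [u]) x"
proof (induction vs arbitrary: x)
  case Nil
  show ?case
    using iter_deriv_differentiable[OF assms, of "[]"] by (simp add: gradient_inner)
next
  case (Cons v vs)
  have "iter_deriv H (vs @ [u]) = (\<lambda>x. iter_deriv (gradient H) vs x \<bullet> u)"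
    using Cons by auto
  moreover have d: "((\<lambda>x. iter_deriv (gradient H) vs x \<bullet> u) has_derivative
      (\<lambda>v. frechet_derivative (iter_deriv (gradient H) vs) (at x) v \<bullet> u)) (at x)"
    using iter_deriv_gradient_differentiable[OF assms]
    by (intro has_derivative_inner_left) (simp add: frechet_derivative_works)
  ultimately show ?case
    by (simp add: frechet_derivative_at[OF d, symmetric])
qed

text \<open>Both pairings are derivatives of \<open>H\<close> that differ only by exchanging the
  outermost direction with the innermost.\<close>

lemma iter_deriv_gradient_self_adjoint:
  fixes H :: "'a::euclidean_space \<Rightarrow> real"
  assumes "C_infinity H"
  shows "iter_deriv (gradient H) (w # vs) x \<bullet> u = w \<bullet> iter_deriv (gradient H) (u # vs) x"
  unfolding inner_commute[of w] iter_deriv_gradient_inner[OF assms]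
  using iter_deriv_exchange[OF assms] by simp

section \<open>The energy along a segment\<close>

lemma gradient_continuous:
  fixes H :: "'a::euclidean_space \<Rightarrow> real"
  assumes "C_infinity H"
  shows "continuous_on X (gradient H)"
  using iter_deriv_gradient_differentiable[OF assms, of "[]"]
  by (auto intro!: continuous_at_imp_continuous_on differentiable_imp_continuous_within)

lemma gradient_segment_integrable:
  fixes H :: "'a::euclidean_space \<Rightarrow> real"
  assumes "C_infinity H"
  shows "(\<lambda>\<xi>. gradient H (\<xi> *\<^sub>R y + (1 - \<xi>) *\<^sub>R x)) integrable_on {0..1}"
  by (intro integrable_continuous_real continuous_on_compose2[OF gradient_continuous[OF assms, of UNIV]]
      continuous_intros) auto

text \<open>The fundamental theorem of calculus along the segment; the constant vector
  \<open>y - x\<close> is then pulled out of the integral.\<close>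

lemma energy_difference:
  fixes H :: "'a::euclidean_space \<Rightarrow> real"
  assumes "C_infinity H"
  shows "H y - H x = (y - x) \<bullet> integral {0..1} (\<lambda>\<xi>. gradient H (\<xi> *\<^sub>R y + (1 - \<xi>) *\<^sub>R x))"
proof -
  let ?p = "\<lambda>\<xi>. \<xi> *\<^sub>R y + (1 - \<xi>) *\<^sub>R x"
  have p: "x + \<xi> *\<^sub>R (y - x) = ?p \<xi>" for \<xi>
    by (simp add: algebra_simps)
  have dH: "H differentiable (at u)" for u
    using iter_deriv_differentiable[OF assms, of "[]"] by simp
  have "((\<lambda>\<xi>. H (?p \<xi>)) has_real_derivative (y - x) \<bullet> gradient H (?p \<xi>)) (at \<xi>)" for \<xi>
    using has_real_derivative_along_line[OF dH, where p = x and t = \<xi> and v = "y - x"]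
    by (simp add: p gradient_inner[OF dH, symmetric] inner_commute)
  then have "((\<lambda>\<xi>. (y - x) \<bullet> gradient H (?p \<xi>)) has_integral H (?p 1) - H (?p 0)) {0..1}"
    by (intro fundamental_theorem_of_calculus)
      (auto simp flip: has_real_derivative_iff_has_vector_derivative
        intro: has_field_derivative_at_within)
  moreover have "((\<lambda>\<xi>. (y - x) \<bullet> gradient H (?p \<xi>)) has_integral
      (y - x) \<bullet> integral {0..1} (\<lambda>\<xi>. gradient H (?p \<xi>))) {0..1}"
    using has_integral_linear[OF integrable_integral[OF gradient_segment_integrable[OF assms]]
        bounded_linear_inner_right[of "y - x"]]
    by (simp add: o_def)
  ultimately show ?thesis
    by (simp add: has_integral_unique)
qed

section \<open>Skew-symmetry of the averaged step\<close>

lemma skew_matrix_inner: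
  fixes S :: "real^'n^'n"
  assumes "transpose S = - S"
  shows "(S *v x) \<bullet> y = - (x \<bullet> (S *v y))"
proof -
  have "(S *v x) \<bullet> y = x \<bullet> (transpose S *v y)"
    by (metis dot_lmul_matrix inner_commute transpose_matrix_vector transpose_transpose)
  then show ?thesis
    \<comment> \<open>The product with \<open>- S\<close> is read as one with
      \<open>0 - S\<close>.\<close>
    using matrix_vector_mult_diff_rdistrib[of 0 S y] by (simp add: assms)
qed

theorem theorem4p4:
  fixes S :: "real^'n^'n" and H :: "real^'n \<Rightarrow> real" and h :: real and z0 z1 :: "real^'n"
  assumes "even CARD('n)"
    and "transpose S = - S"
    and "C_infinity H"
    and "h \<noteq> 0"
    and "avf6_step (hamiltonian_field S H) h z0 z1"
  shows "(1 / h) * (H z1 - H z0) = 0"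
proof -
  define z where "z = (1 / 2) *\<^sub>R (z0 + z1)"
  define f where "f = hamiltonian_field S H"
  define g where "g = integral {0..1} (\<lambda>\<xi>. gradient H (\<xi> *\<^sub>R z1 + (1 - \<xi>) *\<^sub>R z0))"
  \<comment> \<open>\<open>K vs\<close> is a derivative of the gradient at the midpoint as an
    operator on its first direction, the others being frozen. Each \<open>A0\<close>, ...,
    \<open>A8\<close> becomes an alternating word in \<open>S\<close> and such operators.\<close>
  define K where "K = (\<lambda>vs w. iter_deriv (gradient H) (w # vs) z)"
  have f: "f = (\<lambda>x. S *v gradient H x)"
    by (auto simp: f_def hamiltonian_field_def)
  note dG = iter_deriv_gradient_differentiable[OF assms(3)]
  have D: "iter_deriv f (w # vs) z = S *v K vs w" for vs w
    unfolding f K_def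
    using iter_deriv_compose_bounded_linear[OF matrix_vector_mul_bounded_linear dG, of S "w # vs"]
    by metis
  have K: "linear (K vs)" for vs
    unfolding K_def by (rule linear_iter_deriv[OF dG])
  \<comment> \<open>Closure under composition yields the linearity that makes \<open>matrix\<close>
    of each word act as the word itself.\<close>
  have SK: "linear (\<lambda>w. S *v K vs (F w))" if "linear F" for F vs
    using linear_compose[OF linear_compose[OF that K] matrix_vector_mul_linear, of S vs]
    by (simp add: o_def)
  have avf: "integral {0..1} (\<lambda>\<xi>. f (\<xi> *\<^sub>R z1 + (1 - \<xi>) *\<^sub>R z0)) = S *v g"
    unfolding f g_def
    using integral_linear[OF gradient_segment_integrable[OF assms(3)] matrix_vector_mul_bounded_linear]
    by (simp add: o_def)
  have self: "K vs u \<bullet> v = u \<bullet> K vs v" for vs u v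
    unfolding K_def by (rule iter_deriv_gradient_self_adjoint[OF assms(3)])
  note skew = skew_matrix_inner[OF assms(2)]
  note lin = SK linear_ident
  note works = matrix_vector_mul(2)[THEN fun_cong]
  have A0: "A0 f z *v w = S *v K [] (S *v K [] w)" for w
    unfolding A0_def Let_def D by (rule works) (intro lin)
  have A1: "A1 f z *v w = S *v K [] (S *v K [] (S *v K [] (S *v K [] w)))" for w
    unfolding A1_def Let_def D by (rule works) (intro lin)
  have A2: "A2 f z *v w = S *v K [f z] (S *v K [f z] w)" for w
    unfolding A2_def Let_def D by (rule works) (intro lin)
  have A3: "A3 f z *v w = S *v K [] (S *v K [] (S *v K [f z] w))" for w
    unfolding A3_def Let_def D by (rule works) (intro lin)
  have A4: "A4 f z *v w = S *v K [f z] (S *v K [] (S *v K [] w))" for w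
    unfolding A4_def Let_def D by (rule works) (intro lin)
  have A5: "A5 f z *v w = S *v K [] (S *v K [f z, f z] w)" for w
    unfolding A5_def Let_def D by (rule works) (intro lin)
  have A6: "A6 f z *v w = S *v K [f z, f z] (S *v K [] w)" for w
    unfolding A6_def Let_def D by (rule works) (intro lin)
  \<comment> \<open>The direction \<open>f'f\<close> is itself \<open>S *v K [] (f z)\<close>;
    frozen as a parameter of \<open>K\<close>, it leaves self-adjointness intact.\<close>
  have A7: "A7 f z *v w = S *v K [S *v K [] (f z)] (S *v K [] w)" for w
    unfolding A7_def Let_def D by (rule works) (intro lin)
  have A8: "A8 f z *v w = S *v K [] (S *v K [S *v K [] (f z)] w)" for w
    unfolding A8_def Let_def D by (rule works) (intro lin)
  \<comment> \<open>The quadratic form of the product of \<open>A\<close> and \<open>S\<close> at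
    \<open>g\<close>, linear in \<open>A\<close>.\<close>
  define q where "q = (\<lambda>A. (A *v (S *v g)) \<bullet> g)"
  have q_lin: "q (A + B) = q A + q B" "q (A - B) = q A - q B" "q (c *\<^sub>R A) = c * q A" for A B c
    by (simp_all add: q_def matrix_vector_mult_add_rdistrib matrix_vector_mult_diff_rdistrib
        scaleR_matrix_vector_assoc[symmetric] inner_add_left inner_diff_left)
  \<comment> \<open>Transposition reverses each word, every factor \<open>S\<close> contributing a
    minus sign. With the trailing \<open>S\<close>, the words of \<open>A3\<close> and
    \<open>A4\<close> have four such factors and all others an odd number, which fixes the
    signs.\<close>
  have transposed: "q (mat 1) = - q (mat 1)" "q (A0 f z) = - q (A0 f z)"
    "q (A1 f z) = - q (A1 f z)" "q (A2 f z) = - q (A2 f z)"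
    "q (A3 f z) = q (A4 f z)" "q (A5 f z) = - q (A6 f z)" "q (A7 f z) = - q (A8 f z)"
    unfolding q_def A0 A1 A2 A3 A4 A5 A6 A7 A8 matrix_vector_mul_lid
    by (subst inner_commute, simp add: skew self)+
  have "z1 - z0 = (h *\<^sub>R mat 1 - (h ^ 3 / 12) *\<^sub>R A0 f z
      + (h ^ 5 / 720) *\<^sub>R
          (6 *\<^sub>R A1 f z - A2 f z + A3 f z - A4 f z
           - (3 / 2) *\<^sub>R A5 f z - (3 / 2) *\<^sub>R A6 f z
           + 3 *\<^sub>R A7 f z + 3 *\<^sub>R A8 f z)) *v (S *v g)"
    using assms(5) unfolding avf6_step_def Let_def z_def[symmetric] f_def[symmetric] avf
    by (simp only: diff_eq_eq add.commute)
  then have "(z1 - z0) \<bullet> g = q (h *\<^sub>R mat 1 - (h ^ 3 / 12) *\<^sub>R A0 f z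
      + (h ^ 5 / 720) *\<^sub>R
          (6 *\<^sub>R A1 f z - A2 f z + A3 f z - A4 f z
           - (3 / 2) *\<^sub>R A5 f z - (3 / 2) *\<^sub>R A6 f z
           + 3 *\<^sub>R A7 f z + 3 *\<^sub>R A8 f z))"
    by (simp add: q_def)
  also have "\<dots> = 0"
    \<comment> \<open>A value equal to its own negative vanishes. The coefficients of
      \<open>A3\<close> and \<open>A4\<close> are opposite, those of \<open>A5\<close> and
      \<open>A6\<close> agree, and so do those of \<open>A7\<close> and \<open>A8\<close>, so each
      pair cancels.\<close>
    using transposed unfolding q_lin by simp
  finally show ?thesis
    using energy_difference[OF assms(3), of z1 z0] by (simp add: g_def)
qed

end
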